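(* Let $n\ge1$ be a fixed degree, $\omega\in(0,(n+1)\pi)$, and let $r\in\mathcal{U}_n$ be the unitary best approximation $r(\mathrm{i}x)=\mathrm{e}^{\mathrm{i}g(x)}\approx\mathrm{e}^{\mathrm{i}\omega x}$. Let $-1=\eta_1<\dots<\eta_{2n+2}=1$ denote the equioscillation points of the phase error of $r$. Then $$|r(\mathrm{i}\eta_j)-\mathrm{e}^{\mathrm{i}\omega\eta_j}|=\|r-\exp(\omega\cdot)\|,\quad j=1,\dots,2n+2.$$ The equioscillation points are exactly the points of $[-1,1]$ where the approximation error $r(\mathrm{i}x)-\mathrm{e}^{\mathrm{i}\omega x}$ and the phase error $g(x)-\omega x$ attain their maxima in absolute value on $[-1,1]$, and the phase error is strictly monotonic between neighboring equioscillation points. Moreover, the phase error has exactly one simple zero between each pair of neighboring equioscillation points, i.e., there are nodes $x_1,\dots,x_{2n+1}\in\mathbb{R}$ with $x_j\in(\eta_j,\eta_{j+1})$ and $$g(x_j)=\omega x_j,\quad j=1,\dots,2n+1,$$ and $r$ interpolates $\mathrm{e}^{\omega z}$ at the nodes $\mathrm{i}x_1,\dots,\mathrm{i}x_{2n+1}$, i.e., $$r(\mathrm{i}x_j)=\mathrm{e}^{\mathrm{i}\omega x_j},\quad j=1,\dots,2n+1.$$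
   Context: For a complex polynomial $p$ let $p^\dag(z):=\overline{p}(-z)=\overline{p(-\overline z)}$, where $\overline p$ has complex-conjugated coefficients. Let $\mathcal{U}_n:=\{p^\dag/p : p \text{ a complex polynomial of degree}\le n,\ p\not\equiv 0\}$, with rational functions identified with their irreducible form; then $|r(\mathrm{i}x)|=1$ for $r\in\mathcal{U}_n$, $x\in\mathbb{R}$. For a complex function $f$ let $\|f\|:=\max_{x\in[-1,1]}|f(\mathrm{i}x)|$; so $\|r-\exp(\omega\cdot)\|=\max_{x\in[-1,1]}|r(\mathrm{i}x)-\mathrm{e}^{\mathrm{i}\omega x}|$. For $\omega\in(0,(n+1)\pi)$ the unitary best approximation is the unique $r\in\mathcal{U}_n$ with $\|r-\exp(\omega\cdot)\|=\min_{u\in\mathcal{U}_n}\|u-\exp(\omega\cdot)\|$; this minimum is $<2$. Phase function: if $r\in\mathcal{U}_n$ (in irreducible form) has poles $s_j=\xi_j+\mathrm{i}\mu_j$, $j=1,\dots,m$ (then $\xi_j\neq0$), and $\|r-\exp(\omega\cdot)\|<2$, then there is a unique function of the form $g(x)=\theta+2\sum_{j=1}^m\arctan\big(\frac{x-\mu_j}{\xi_j}\big)$, $\theta\in\mathbb{R}$, with $r(\mathrm{i}x)=\mathrm{e}^{\mathrm{i}g(x)}$ for $x\in\mathbb{R}$ and $\max_{x\in[-1,1]}|g(x)-\omega x|<\pi$. The phase error of $r$ is $g(x)-\omega x$. The phase error equioscillates between points $-1\le\eta_1<\dots<\eta_k\le1$ if $g(\eta_j)-\omega\eta_j=(-1)^{j+\iota}\max_{x\in[-1,1]}|g(x)-\omega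 x|$ for $j=1,\dots,k$ and some $\iota\in\{0,1\}$; the $\eta_j$ are called equioscillation points. For $\omega\in(0,(n+1)\pi)$ the unitary best approximation has exactly $2n+2$ equioscillation points, including $-1$ and $1$. *)

theory Defs
  imports
    "HOL-Analysis.Analysis"
    "HOL-Computational_Algebra.Computational_Algebra"
    "HOL-Computational_Algebra.Field_as_Ring"
begin

definition dagger :: "complex poly \<Rightarrow> complex poly" where
  "dagger p = pcompose (map_poly cnj p) [:0, -1:]"

lemma poly_dagger: "poly (dagger p) z = cnj (poly p (- cnj z))"
  by (simp add: dagger_def poly_pcompose)

text \<open>
  Rational functions are elements of the fraction field of the polynomial ring;
  \<^const>\<open>quot_of_fract\<close> yields the irreducible form (coprime numerator and denominator,
  the denominator being monic).
\<close>

definition unitary_ratfuns :: "nat \<Rightarrow> complex poly fract set" where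
  "unitary_ratfuns n = {Fract (dagger p) p | p. degree p \<le> n \<and> p \<noteq> 0}"

definition ratfun_eval :: "complex poly fract \<Rightarrow> complex \<Rightarrow> complex" where
  "ratfun_eval r z = poly (fst (quot_of_fract r)) z / poly (snd (quot_of_fract r)) z"

lemma ratfun_eval_Fract:
  assumes "poly b z \<noteq> 0"
  shows "ratfun_eval (Fract a b) z = poly a z / poly b z"
proof -
  define c d where "c = fst (quot_of_fract (Fract a b))" and "d = snd (quot_of_fract (Fract a b))"
  have d0: "d \<noteq> 0" and b0: "b \<noteq> 0"
    using assms by (auto simp: d_def)
  have "Fract c d = Fract a b"
    by (simp add: c_def d_def)
  then have eq: "c * b = a * d"
    using d0 b0 by (simp add: eq_fract)
  have "coprime c d"
    unfolding c_def d_def by (rule coprime_quot_of_fract)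
  then have "d dvd b"
    using eq by (metis coprime_commute coprime_dvd_mult_right_iff dvd_triv_right)
  then have "poly d z \<noteq> 0"
    using assms by (auto simp: dvd_def)
  moreover have "poly c z * poly b z = poly a z * poly d z"
    using eq by (metis poly_mult)
  ultimately show ?thesis
    using assms by (simp add: ratfun_eval_def c_def[symmetric] d_def[symmetric] divide_simps)
qed

text \<open>Poles are counted with multiplicity.\<close>

definition ratfun_poles :: "complex poly fract \<Rightarrow> complex multiset" where
  "ratfun_poles r = proots (snd (quot_of_fract r))"

definition seg_norm :: "(real \<Rightarrow> 'a::real_normed_vector) \<Rightarrow> real" where
  "seg_norm e = (SUP x\<in>{-1..1}. norm (e x))"

definition imag_norm :: "(complex \<Rightarrow> complex) \<Rightarrow> real" where
  "imag_norm f = seg_norm (\<lambda>x. f (\<i> * of_real x))"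

definition approx_error :: "real \<Rightarrow> complex poly fract \<Rightarrow> complex \<Rightarrow> complex" where
  "approx_error \<omega> r z = ratfun_eval r z - exp (of_real \<omega> * z)"

definition unitary_best_approx :: "nat \<Rightarrow> real \<Rightarrow> complex poly fract \<Rightarrow> bool" where
  "unitary_best_approx n \<omega> r \<longleftrightarrow>
     r \<in> unitary_ratfuns n \<and>
     (\<forall>u\<in>unitary_ratfuns n. imag_norm (approx_error \<omega> r) \<le> imag_norm (approx_error \<omega> u))"

definition phase_error :: "real \<Rightarrow> (real \<Rightarrow> real) \<Rightarrow> real \<Rightarrow> real" where
  "phase_error \<omega> g x = g x - \<omega> * x"

definition phase_function :: "real \<Rightarrow> complex poly fract \<Rightarrow> (real \<Rightarrow> real) \<Rightarrow> bool" where
  "phase_function \<omega> r g \<longleftrightarrow>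
     (\<exists>\<theta>. \<forall>x. g x = \<theta> + 2 * (\<Sum>s\<in>#ratfun_poles r. arctan ((x - Im s) / Re s))) \<and>
     (\<forall>x. ratfun_eval r (\<i> * of_real x) = exp (\<i> * of_real (g x))) \<and>
     seg_norm (phase_error \<omega> g) < pi"

text \<open>The points are \<open>\<eta> 1 < \<dots> < \<eta> k\<close>; values of \<open>\<eta>\<close> outside \<open>{1..k}\<close> are irrelevant.\<close>

definition equioscillates :: "(real \<Rightarrow> real) \<Rightarrow> nat \<Rightarrow> (nat \<Rightarrow> real) \<Rightarrow> bool" where
  "equioscillates e k \<eta> \<longleftrightarrow>
     (\<forall>j\<in>{1..k}. \<eta> j \<in> {-1..1}) \<and> strict_mono_on {1..k} \<eta> \<and>
     (\<exists>\<iota>\<in>{0, 1::nat}. \<forall>j\<in>{1..k}. e (\<eta> j) = (-1) ^ (j + \<iota>) * seg_norm e)"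

definition simple_zero :: "(real \<Rightarrow> real) \<Rightarrow> real \<Rightarrow> bool" where
  "simple_zero e x \<longleftrightarrow> e x = 0 \<and> (\<exists>D. D \<noteq> 0 \<and> (e has_real_derivative D) (at x))"

end

theory Submission
  imports Defs
begin

text \<open>
  Write \<open>e = phase_error \<omega> g\<close> and \<open>M = seg_norm e\<close>. Differentiating the arctangents shows that
  \<open>e'\<close> is a sum of at most \<open>n\<close> terms with quadratic denominators, minus the constant \<open>\<omega> \<noteq> 0\<close>.
  Clearing denominators turns \<open>e'\<close> into a nonzero real polynomial of degree at most \<open>2n\<close>, so \<open>e\<close>
  has at most \<open>2n\<close> critical points on the real line (lemma \<open>critical_points_arctan_sum\<close>).

  The \<open>2n\<close> interior equioscillation points are local extrema, hence critical points, and so they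
  are all the critical points. Everything about the phase error follows from this count: any other
  interior point with \<open>\<bar>e\<bar> = M\<close> would be one more critical point; between neighbors
  Rolle's theorem makes \<open>e\<close> injective, hence strictly monotonic; and since \<open>e\<close> passes from
  \<open>\<plusminus>M\<close> to \<open>\<mp>M\<close>, it has exactly one zero there, at which \<open>e'\<close> does not vanish. This argument
  applies to every differentiable function with so few critical points; it is carried out in the
  locale \<open>equioscillation_few_critical\<close>.

  The approximation error has absolute value \<open>2 \<bar>sin (e x / 2)\<bar>\<close>. Because \<open>\<bar>e\<bar> \<le> M < \<pi>\<close>, it is a
  strictly increasing function of \<open>\<bar>e x\<bar>\<close>, so both errors attain their maxima at the same points.
\<close>

section \<open>Critical points of sums of arctangents\<close>

text \<open>
  Adding a summand with denominator \<open>q\<close> replaces the common denominator \<open>D\<close> by \<open>q D\<close> and the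
  numerator \<open>N\<close> by \<open>q N + Re s D\<close>. If \<open>Re s = 0\<close>, the new summand is \<open>0\<close>, also at the
  zero \<open>Im s\<close> of \<open>q\<close>, in agreement with these formulas.
\<close>

lemma common_denominator:
  fixes A :: "complex multiset"
  shows "\<exists>D N :: real poly. D \<noteq> 0 \<and> degree D = 2 * size A \<and> (N = 0 \<or> degree N < degree D) \<and>
    (\<forall>x. poly D x * (\<Sum>s\<in>#A. Re s / ((Re s)\<^sup>2 + (x - Im s)\<^sup>2)) = poly N x)"
proof (induction A)
  case empty
  show ?case by (rule exI[of _ 1], rule exI[of _ 0]) simp
next
  case (add s A)
  then obtain D N :: "real poly" where D: "D \<noteq> 0" "degree D = 2 * size A"
    and N: "N = 0 \<or> degree N < degree D"
    and eq: "\<And>x. poly D x * (\<Sum>s\<in>#A. Re s / ((Re s)\<^sup>2 + (x - Im s)\<^sup>2)) = poly N x"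
    by blast
  define q where "q = [:(Re s)\<^sup>2 + (Im s)\<^sup>2, - 2 * Im s, 1:]"
  have q: "poly q x = (Re s)\<^sup>2 + (x - Im s)\<^sup>2" for x
    by (simp add: q_def power2_eq_square algebra_simps)
  have q_deg: "degree q = 2" "q \<noteq> 0" by (simp_all add: q_def)
  have deg: "degree (q * D) = 2 * size (add_mset s A)"
    using q_deg D by (simp add: degree_mult_eq)
  have "degree (q * N + smult (Re s) D) < 2 * size (add_mset s A)"
  proof -
    have "degree (q * N) < 2 * size (add_mset s A)"
      using N D q_deg by (cases "N = 0") (auto simp: degree_mult_eq)
    moreover have "degree (smult (Re s) D) < 2 * size (add_mset s A)"
      using D by simp
    ultimately show ?thesis by (rule degree_add_less)
  qed
  moreover have "poly (q * D) x *
      (\<Sum>s\<in>#add_mset s A. Re s / ((Re s)\<^sup>2 + (x - Im s)\<^sup>2)) = poly (q * N + smult (Re s) D) x" for x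
  proof -
    have "poly q x * (Re s / poly q x) = Re s"
      by (cases "poly q x = 0") (auto simp: q sum_power2_eq_zero_iff)
    then have "poly D x * (poly q x * (Re s / poly q x)) = poly D x * Re s" by simp
    then show ?thesis
      by (simp add: eq[of x, symmetric] algebra_simps flip: q)
  qed
  moreover have "q * D \<noteq> 0"
    using D(1) q_deg(2) by simp
  ultimately show ?case
    using deg by (intro exI[of _ "q * D"] exI[of _ "q * N + smult (Re s) D"]) simp
qed

text \<open>
  A critical point is a zero of \<open>2 N - \<omega> D\<close>, which has the same degree as \<open>D\<close> because \<open>\<omega> \<noteq> 0\<close>
  and \<open>N\<close> has smaller degree.
\<close>

lemma critical_points_arctan_sum:
  fixes A :: "complex multiset"
  assumes "\<omega> \<noteq> 0"
  defines "C \<equiv> {x. 2 * (\<Sum>s\<in>#A. Re s / ((Re s)\<^sup>2 + (x - Im s)\<^sup>2)) - \<omega> = 0}"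
  shows "finite C" and "card C \<le> 2 * size A"
proof -
  obtain D N :: "real poly" where D: "D \<noteq> 0" "degree D = 2 * size A"
    and N: "N = 0 \<or> degree N < degree D"
    and eq: "\<And>x. poly D x * (\<Sum>s\<in>#A. Re s / ((Re s)\<^sup>2 + (x - Im s)\<^sup>2)) = poly N x"
    using common_denominator by blast
  define P where "P = smult 2 N - smult \<omega> D"
  have "coeff P (degree D) = - \<omega> * lead_coeff D"
    using N by (auto simp: P_def coeff_eq_0)
  then have P: "P \<noteq> 0"
    using assms(1) D(1) by (metis coeff_0 leading_coeff_0_iff mult_eq_0_iff neg_equal_0_iff_equal)
  have "degree P \<le> 2 * size A"
    unfolding P_def using N D by (intro degree_diff_le) auto
  then have roots: "finite {x. poly P x = 0}" "card {x. poly P x = 0} \<le> 2 * size A"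
    using poly_roots_finite[OF P] card_poly_roots_bound[OF P] by auto
  have sub: "C \<subseteq> {x. poly P x = 0}"
  proof
    fix x assume "x \<in> C"
    then have "2 * (\<Sum>s\<in>#A. Re s / ((Re s)\<^sup>2 + (x - Im s)\<^sup>2)) = \<omega>"
      by (simp add: C_def)
    then have "2 * poly N x = poly D x * \<omega>"
      unfolding eq[symmetric] by (metis mult.left_commute)
    then show "x \<in> {x. poly P x = 0}"
      by (simp add: P_def mult.commute)
  qed
  show "finite C"
    by (rule finite_subset[OF sub roots(1)])
  show "card C \<le> 2 * size A"
    by (rule le_trans[OF card_mono[OF roots(1) sub] roots(2)])
qed

text \<open>For \<open>a = 0\<close> the function and its derivative vanish, since division by zero yields zero.\<close>

lemma has_real_derivative_arctan_quotient:
  "((\<lambda>x. arctan ((x - b) / a)) has_real_derivative a / (a\<^sup>2 + (x - b)\<^sup>2)) (at x)"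
proof (cases "a = 0")
  case False
  have "((\<lambda>x. arctan ((x - b) / a)) has_real_derivative
      inverse (1 + ((x - b) / a)\<^sup>2) * (1 / a)) (at x)"
    using False by (auto intro!: derivative_eq_intros)
  moreover have "inverse (1 + ((x - b) / a)\<^sup>2) * (1 / a) = a / (a\<^sup>2 + (x - b)\<^sup>2)"
  proof -
    have "1 + ((x - b) / a)\<^sup>2 = (a\<^sup>2 + (x - b)\<^sup>2) / a\<^sup>2"
      using False by (simp add: power_divide add_divide_distrib)
    then show ?thesis
      using False by (simp add: power2_eq_square)
  qed
  ultimately show ?thesis by simp
qed simp

lemma has_real_derivative_arctan_sum:
  fixes A :: "complex multiset"
  shows "((\<lambda>x. \<Sum>s\<in>#A. arctan ((x - Im s) / Re s)) has_real_derivative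
    (\<Sum>s\<in>#A. Re s / ((Re s)\<^sup>2 + (x - Im s)\<^sup>2))) (at x)"
proof (induction A)
  case (add s A)
  then show ?case
    using DERIV_add[OF has_real_derivative_arctan_quotient add] by simp
qed simp

text \<open>Passing to the irreducible form can only lower the degree: its denominator divides that of \<open>p\<^sup>\<dagger> / p\<close>.\<close>

lemma size_ratfun_poles_le:
  assumes "r \<in> unitary_ratfuns n"
  shows "size (ratfun_poles r) \<le> n"
proof -
  obtain p where p: "r = Fract (dagger p) p" "degree p \<le> n" "p \<noteq> 0"
    using assms by (auto simp: unitary_ratfuns_def)
  define c d where "c = fst (quot_of_fract r)" and "d = snd (quot_of_fract r)"
  have d0: "d \<noteq> 0" by (simp add: d_def)
  have "Fract c d = Fract (dagger p) p"
    by (simp add: c_def d_def flip: p(1))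
  then have "c * p = dagger p * d"
    using d0 p by (simp add: eq_fract)
  moreover have "coprime c d"
    unfolding c_def d_def by (rule coprime_quot_of_fract)
  ultimately have "d dvd p"
    by (metis coprime_commute coprime_dvd_mult_right_iff dvd_triv_right)
  then have "degree d \<le> n"
    using p dvd_imp_degree_le le_trans by blast
  then show ?thesis
    using size_proots_le[of d] by (simp add: ratfun_poles_def d_def)
qed

section \<open>Equioscillation with the fewest possible critical points\<close>

text \<open>
  Of the \<open>k\<close> equioscillation points, all but \<open>\<plusminus>1\<close> are local extrema in the interior. So there are
  at least \<open>k - 2\<close> critical points, and the bound \<open>card_critical\<close> leaves room for no others.
\<close>

locale equioscillation_few_critical =
  fixes e e' :: "real \<Rightarrow> real" and k :: nat and \<eta> :: "nat \<Rightarrow> real"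
  assumes k: "2 \<le> k"
    and deriv: "\<And>x. (e has_real_derivative e' x) (at x)"
    and finite_critical: "finite {x. e' x = 0}"
    and card_critical: "card {x. e' x = 0} \<le> k - 2"
    and equi: "equioscillates e k \<eta>"
    and eta_first: "\<eta> 1 = -1"
    and eta_last: "\<eta> k = 1"
begin

lemma continuous_on_e: "continuous_on S e"
  using deriv DERIV_isCont continuous_at_imp_continuous_on by blast

lemma abs_le_seg_norm:
  assumes "x \<in> {-1..1}"
  shows "\<bar>e x\<bar> \<le> seg_norm e"
proof -
  have "compact ((\<lambda>x. norm (e x)) ` {-1..1})"
    by (intro compact_continuous_image continuous_on_norm continuous_on_e) simp
  then have "bdd_above ((\<lambda>x. norm (e x)) ` {-1..1})"
    by (intro bounded_imp_bdd_above compact_imp_bounded)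
  then have "norm (e x) \<le> (SUP x\<in>{-1..1}. norm (e x))"
    using assms by (rule cSUP_upper2) simp
  then show ?thesis by (simp add: seg_norm_def)
qed

lemma eta_less: "i \<in> {1..k} \<Longrightarrow> j \<in> {1..k} \<Longrightarrow> i < j \<Longrightarrow> \<eta> i < \<eta> j"
  using equi by (auto simp: equioscillates_def strict_mono_on_def)

lemma eta_mem: "j \<in> {1..k} \<Longrightarrow> \<eta> j \<in> {-1..1}"
  using equi by (auto simp: equioscillates_def)

lemma seg_norm_nonneg: "0 \<le> seg_norm e"
  using abs_le_seg_norm[of 0] by simp

lemma abs_eta: "j \<in> {1..k} \<Longrightarrow> \<bar>e (\<eta> j)\<bar> = seg_norm e"
  using equi seg_norm_nonneg by (auto simp: equioscillates_def abs_mult power_abs)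

lemma eta_alternate: "j \<in> {1..k} \<Longrightarrow> j + 1 \<in> {1..k} \<Longrightarrow> e (\<eta> (j + 1)) = - e (\<eta> j)"
  using equi by (auto simp: equioscillates_def)

lemma extremal_imp_critical:
  assumes "x \<in> {-1<..<1}" and "\<bar>e x\<bar> = seg_norm e"
  shows "e' x = 0"
proof -
  define d where "d = min (x + 1) (1 - x)"
  have d: "d > 0" using assms by (simp add: d_def)
  have le: "\<bar>e y\<bar> \<le> seg_norm e" if "\<bar>x - y\<bar> < d" for y
    using that by (intro abs_le_seg_norm) (auto simp: d_def)
  show ?thesis
  proof (cases "e x \<ge> 0")
    case True
    then have "\<forall>y. \<bar>x - y\<bar> < d \<longrightarrow> e y \<le> e x" using le assms(2) by fastforce
    then show ?thesis by (rule DERIV_local_max[OF deriv d])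
  next
    case False
    then have "\<forall>y. \<bar>x - y\<bar> < d \<longrightarrow> e x \<le> e y" using le assms(2) by fastforce
    then show ?thesis by (rule DERIV_local_min[OF deriv d])
  qed
qed

lemma eta_interior:
  assumes "j \<in> {2..k - 1}"
  shows "\<eta> j \<in> {-1<..<1}"
  using eta_less[of 1 j] eta_less[of j k] eta_first eta_last assms by auto

lemma critical_points: "{x. e' x = 0} = \<eta> ` {2..k - 1}"
proof (rule sym, rule card_seteq[OF finite_critical])
  show "\<eta> ` {2..k - 1} \<subseteq> {x. e' x = 0}"
  proof safe
    fix j assume "j \<in> {2..k - 1}"
    then show "e' (\<eta> j) = 0"
      by (intro extremal_imp_critical eta_interior abs_eta) auto
  qed
  have "inj_on \<eta> {2..k - 1}"
  proof (rule linorder_inj_onI')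
    fix i j assume "i \<in> {2..k - 1}" "j \<in> {2..k - 1}" "i < j"
    then have "\<eta> i < \<eta> j" by (intro eta_less) auto
    then show "\<eta> i \<noteq> \<eta> j" by simp
  qed
  then show "card {x. e' x = 0} \<le> card (\<eta> ` {2..k - 1})"
    using card_critical k by (simp add: card_image)
qed

text \<open>
  The sign changes of \<open>e\<close> between neighboring equioscillation points need a positive maximum. If \<open>e\<close>
  vanished on the segment, there would be infinitely many critical points.
\<close>

lemma seg_norm_pos: "0 < seg_norm e"
proof (rule ccontr)
  assume "\<not> 0 < seg_norm e"
  then have M: "seg_norm e = 0" using seg_norm_nonneg by simp
  have "{-1<..<1} \<subseteq> {x. e' x = 0}"
  proof
    fix x :: real assume x: "x \<in> {-1<..<1}"
    have "\<bar>e x\<bar> = seg_norm e" using abs_le_seg_norm[of x] x M by simp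
    with x show "x \<in> {x. e' x = 0}" using extremal_imp_critical by simp
  qed
  then have "finite {-1<..<1::real}"
    using finite_critical finite_subset by blast
  then show False using infinite_Ioo[of "-1" "1::real"] by simp
qed

lemma extremal_points: "\<eta> ` {1..k} = {x \<in> {-1..1}. \<bar>e x\<bar> = seg_norm e}"
proof (intro equalityI subsetI)
  fix x assume "x \<in> \<eta> ` {1..k}"
  then show "x \<in> {x \<in> {-1..1}. \<bar>e x\<bar> = seg_norm e}"
    using eta_mem abs_eta by blast
next
  fix x assume x: "x \<in> {x \<in> {-1..1}. \<bar>e x\<bar> = seg_norm e}"
  consider "x = -1" | "x = 1" | "x \<in> {-1<..<1}" using x by fastforce
  then show "x \<in> \<eta> ` {1..k}"
  proof cases
    case 1
    then show ?thesis using eta_first k by (intro image_eqI[of _ _ 1]) auto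
  next
    case 2
    then show ?thesis using eta_last k by (intro image_eqI[of _ _ k]) auto
  next
    case 3
    then have "x \<in> {x. e' x = 0}" using extremal_imp_critical x by simp
    then show ?thesis unfolding critical_points by auto
  qed
qed

lemma deriv_nonzero_between:
  assumes "j \<in> {1..k - 1}" and "x \<in> {\<eta> j<..<\<eta> (j + 1)}"
  shows "e' x \<noteq> 0"
proof
  assume "e' x = 0"
  then obtain i where i: "i \<in> {2..k - 1}" "x = \<eta> i"
    using critical_points by blast
  consider "i \<le> j" | "j + 1 \<le> i" by linarith
  then show False
    
  proof cases
    case 1
    have "i \<in> {1..k}" "j \<in> {1..k}" using i(1) assms(1) by auto
    then have "\<eta> i \<le> \<eta> j"
      using 1 eta_less[of i j] by (cases "i = j") auto
    then show False using i(2) assms(2) by simp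
  next
    case 2
    have "i \<in> {1..k}" "j + 1 \<in> {1..k}" using i(1) assms(1) k by auto
    then have "\<eta> (j + 1) \<le> \<eta> i"
      using 2 eta_less[of "j + 1" i] by (cases "i = j + 1") auto
    then show False using i(2) assms(2) by simp
  qed
qed

lemma strictly_monotonic_between:
  assumes j: "j \<in> {1..k - 1}"
  shows "strict_mono_on {\<eta> j..\<eta> (j + 1)} e \<or> strict_antimono_on {\<eta> j..\<eta> (j + 1)} e"
proof -
  have "inj_on e {\<eta> j..\<eta> (j + 1)}"
  proof (rule linorder_inj_onI')
    fix x y assume xy: "x \<in> {\<eta> j..\<eta> (j + 1)}" "y \<in> {\<eta> j..\<eta> (j + 1)}" "x < y"
    show "e x \<noteq> e y"
    proof
      assume "e x = e y"
      then obtain z where "x < z" "z < y" "e' z = 0"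
        using Rolle_deriv[OF xy(3), of e "\<lambda>z. (*) (e' z)"] continuous_on_e deriv
        by (metis (mono_tags) has_field_derivative_def mult.right_neutral)
      then show False using deriv_nonzero_between[OF j, of z] xy by auto
    qed
  qed
  then show ?thesis
    using injective_eq_monotone_map[OF is_interval_cc continuous_on_e] by blast
qed

lemma unique_simple_zero_between:
  assumes j: "j \<in> {1..k - 1}"
  shows "\<exists>x. x \<in> {\<eta> j<..<\<eta> (j + 1)} \<and> {y \<in> {\<eta> j<..<\<eta> (j + 1)}. e y = 0} = {x} \<and> simple_zero e x"
proof -
  let ?a = "\<eta> j" and ?b = "\<eta> (j + 1)"
  have ab: "?a < ?b" using j by (intro eta_less) auto
  have opp: "e ?b = - e ?a" using j by (intro eta_alternate) auto
  have nz: "e ?a \<noteq> 0" 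
  proof -
    have "\<bar>e ?a\<bar> = seg_norm e" using j by (intro abs_eta) auto
    then show ?thesis using seg_norm_pos by auto
  qed
  have "\<exists>x\<ge>?a. x \<le> ?b \<and> e x = 0"
  proof (cases "e ?a \<le> 0")
    case True
    then show ?thesis using IVT'[of e ?a 0 ?b] opp ab continuous_on_e by auto
  next
    case False
    then show ?thesis using IVT2'[of e ?b 0 ?a] opp ab continuous_on_e by auto
  qed
  then obtain x where x: "?a \<le> x" "x \<le> ?b" "e x = 0" by blast
  have x_in: "x \<in> {?a<..<?b}"
    using x nz opp by (auto simp: less_le)
  have inj: "inj_on e {?a..?b}"
    by (rule injective_eq_monotone_map[OF is_interval_cc continuous_on_e, THEN iffD2])
      (rule strictly_monotonic_between[OF j])
  have "y = x" if "y \<in> {?a<..<?b}" "e y = 0" for y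
    by (rule inj_onD[OF inj]) (use that x in auto)
  then have "{y \<in> {?a<..<?b}. e y = 0} = {x}"
    using x(3) x_in by blast
  moreover have "simple_zero e x"
    unfolding simple_zero_def using x(3) deriv[of x] deriv_nonzero_between[OF j x_in] by blast
  ultimately show ?thesis using x_in by blast
qed

end

section \<open>From the phase error to the approximation error\<close>

lemma norm_approx_error:
  assumes "ratfun_eval r (\<i> * of_real x) = exp (\<i> * of_real (g x))"
  shows "norm (approx_error \<omega> r (\<i> * of_real x)) = 2 * \<bar>sin (phase_error \<omega> g x / 2)\<bar>"
proof -
  have "approx_error \<omega> r (\<i> * of_real x) =
      exp (\<i> * of_real (\<omega> * x)) * (exp (\<i> * of_real (phase_error \<omega> g x)) - 1)"
    by (simp add: approx_error_def assms phase_error_def algebra_simps flip: exp_add)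
  then have "norm (approx_error \<omega> r (\<i> * of_real x)) =
      norm (exp (\<i> * of_real (phase_error \<omega> g x)) - 1)"
    by (simp only: norm_mult norm_exp_i_times mult_1)
  then show ?thesis by (simp add: dist_exp_i_1)
qed

lemma abs_sin_half_le_iff:
  assumes "\<bar>s\<bar> \<le> pi" and "\<bar>t\<bar> \<le> pi"
  shows "\<bar>sin (s / 2)\<bar> \<le> \<bar>sin (t / 2)\<bar> \<longleftrightarrow> \<bar>s\<bar> \<le> \<bar>t\<bar>"
proof -
  have "\<bar>sin (u / 2)\<bar> = sin (\<bar>u\<bar> / 2)" if "\<bar>u\<bar> \<le> pi" for u :: real
    using that sin_ge_zero[of "\<bar>u\<bar> / 2"] by (cases "u \<ge> 0") auto
  then show ?thesis
    using assms by (simp add: sin_mono_le_eq)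
qed

theorem corollary5p2:
  fixes n :: nat and \<omega> :: real and r :: "complex poly fract"
    and g :: "real \<Rightarrow> real" and \<eta> :: "nat \<Rightarrow> real"
  assumes "n \<ge> 1"
    and "0 < \<omega>" and "\<omega> < (real n + 1) * pi"
    and "unitary_best_approx n \<omega> r"
    and "phase_function \<omega> r g"
    and "equioscillates (phase_error \<omega> g) (2 * n + 2) \<eta>"
    and "\<eta> 1 = -1" and "\<eta> (2 * n + 2) = 1"
  shows
    "(\<forall>j\<in>{1..2 * n + 2}.
        cmod (ratfun_eval r (\<i> * of_real (\<eta> j)) - exp (\<i> * of_real (\<omega> * \<eta> j)))
          = imag_norm (approx_error \<omega> r)) \<and>
     \<eta> ` {1..2 * n + 2} =
        {x \<in> {-1..1}. cmod (approx_error \<omega> r (\<i> * of_real x)) = imag_norm (approx_error \<omega> r)} \<and>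
     \<eta> ` {1..2 * n + 2} =
        {x \<in> {-1..1}. \<bar>phase_error \<omega> g x\<bar> = seg_norm (phase_error \<omega> g)} \<and>
     (\<forall>j\<in>{1..2 * n + 1}.
        strict_mono_on {\<eta> j..\<eta> (j + 1)} (phase_error \<omega> g) \<or>
        strict_antimono_on {\<eta> j..\<eta> (j + 1)} (phase_error \<omega> g)) \<and>
     (\<exists>x :: nat \<Rightarrow> real. \<forall>j\<in>{1..2 * n + 1}.
        x j \<in> {\<eta> j<..<\<eta> (j + 1)} \<and>
        {y \<in> {\<eta> j<..<\<eta> (j + 1)}. phase_error \<omega> g y = 0} = {x j} \<and>
        simple_zero (phase_error \<omega> g) (x j) \<and>
        g (x j) = \<omega> * x j \<and>
        ratfun_eval r (\<i> * of_real (x j)) = exp (\<i> * of_real (\<omega> * x j)))"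
proof -
  let ?e = "phase_error \<omega> g" and ?A = "ratfun_poles r"
  define e' where "e' x = 2 * (\<Sum>s\<in>#?A. Re s / ((Re s)\<^sup>2 + (x - Im s)\<^sup>2)) - \<omega>" for x
  obtain \<theta> where g: "\<And>x. g x = \<theta> + 2 * (\<Sum>s\<in>#?A. arctan ((x - Im s) / Re s))"
    using assms(5) by (auto simp: phase_function_def)
  have eval: "ratfun_eval r (\<i> * of_real x) = exp (\<i> * of_real (g x))" for x
    using assms(5) by (simp add: phase_function_def)
  have M_pi: "seg_norm ?e < pi"
    using assms(5) by (simp add: phase_function_def)

  have deriv: "(?e has_real_derivative e' x) (at x)" for x
  proof -
    have "?e = (\<lambda>x. \<theta> + 2 * (\<Sum>s\<in>#?A. arctan ((x - Im s) / Re s)) - \<omega> * x)"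
      by (simp add: fun_eq_iff phase_error_def g)
    then show ?thesis
      by (auto simp: e'_def intro!: derivative_eq_intros has_real_derivative_arctan_sum)
  qed
  have "size ?A \<le> n"
    using assms(4) by (intro size_ratfun_poles_le) (simp add: unitary_best_approx_def)
  then have critical: "finite {x. e' x = 0}" "card {x. e' x = 0} \<le> 2 * n + 2 - 2"
    using critical_points_arctan_sum[of \<omega> ?A] assms(2) by (auto simp: e'_def)
  interpret equioscillation_few_critical ?e e' "2 * n + 2" \<eta>
    using assms(6-8) deriv critical by unfold_locales auto

  have abs_le_pi: "\<bar>?e x\<bar> \<le> pi" if "x \<in> {-1..1}" for x
    using abs_le_seg_norm[OF that] M_pi by simp
  have error: "norm (approx_error \<omega> r (\<i> * of_real x)) = 2 * \<bar>sin (?e x / 2)\<bar>" for x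
    by (rule norm_approx_error[OF eval])
  have error_le_iff: "norm (approx_error \<omega> r (\<i> * of_real x)) \<le> 2 * \<bar>sin (seg_norm ?e / 2)\<bar>
      \<longleftrightarrow> \<bar>?e x\<bar> \<le> seg_norm ?e"
    "2 * \<bar>sin (seg_norm ?e / 2)\<bar> \<le> norm (approx_error \<omega> r (\<i> * of_real x))
      \<longleftrightarrow> seg_norm ?e \<le> \<bar>?e x\<bar>" if "x \<in> {-1..1}" for x
    using abs_sin_half_le_iff[of "?e x" "seg_norm ?e"] abs_sin_half_le_iff[of "seg_norm ?e" "?e x"]
      abs_le_pi[OF that] M_pi seg_norm_nonneg by (simp_all add: error)
  have error_eq_iff: "norm (approx_error \<omega> r (\<i> * of_real x)) = 2 * \<bar>sin (seg_norm ?e / 2)\<bar>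
      \<longleftrightarrow> \<bar>?e x\<bar> = seg_norm ?e" if "x \<in> {-1..1}" for x
    using error_le_iff[OF that] by linarith
  have norm_eq: "imag_norm (approx_error \<omega> r) = 2 * \<bar>sin (seg_norm ?e / 2)\<bar>"
    unfolding imag_norm_def seg_norm_def[of "\<lambda>x. approx_error \<omega> r (\<i> * of_real x)"]
  proof (rule cSup_eq_maximum)
    have "\<eta> 1 \<in> {-1..1}" "\<bar>?e (\<eta> 1)\<bar> = seg_norm ?e"
      by (auto intro!: eta_mem abs_eta simp del: atLeastAtMost_iff) auto
    then show "2 * \<bar>sin (seg_norm ?e / 2)\<bar> \<in>
        (\<lambda>x. norm (approx_error \<omega> r (\<i> * of_real x))) ` {-1..1}"
      using error_eq_iff by (metis image_eqI)
  next
    fix y assume "y \<in> (\<lambda>x. norm (approx_error \<omega> r (\<i> * of_real x))) ` {-1..1}"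
    then show "y \<le> 2 * \<bar>sin (seg_norm ?e / 2)\<bar>"
      using error_le_iff(1) abs_le_seg_norm by blast
  qed

  have ext: "\<eta> ` {1..2 * n + 2} =
      {x \<in> {-1..1}. cmod (approx_error \<omega> r (\<i> * of_real x)) = imag_norm (approx_error \<omega> r)}"
    unfolding extremal_points norm_eq using error_eq_iff by blast
  have at_eta: "cmod (ratfun_eval r (\<i> * of_real (\<eta> j)) - exp (\<i> * of_real (\<omega> * \<eta> j)))
      = imag_norm (approx_error \<omega> r)" if "j \<in> {1..2 * n + 2}" for j
  proof -
    have "cmod (approx_error \<omega> r (\<i> * of_real (\<eta> j))) = imag_norm (approx_error \<omega> r)"
      using ext that by blast
    then show ?thesis by (simp add: approx_error_def mult.left_commute)
  qed
  have "\<exists>x. \<forall>j\<in>{1..2 * n + 1}. x j \<in> {\<eta> j<..<\<eta> (j + 1)} \<and>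
      {y \<in> {\<eta> j<..<\<eta> (j + 1)}. ?e y = 0} = {x j} \<and> simple_zero ?e (x j)"
    using unique_simple_zero_between by (intro bchoice ballI) simp
  then obtain x where x: "\<forall>j\<in>{1..2 * n + 1}. x j \<in> {\<eta> j<..<\<eta> (j + 1)} \<and>
      {y \<in> {\<eta> j<..<\<eta> (j + 1)}. ?e y = 0} = {x j} \<and> simple_zero ?e (x j)"
    by blast
  have g_node: "g (x j) = \<omega> * x j" if "j \<in> {1..2 * n + 1}" for j
    using x that by (auto simp: simple_zero_def phase_error_def)
  have r_node: "ratfun_eval r (\<i> * of_real (x j)) = exp (\<i> * of_real (\<omega> * x j))"
    if "j \<in> {1..2 * n + 1}" for j
    by (simp only: eval g_node[OF that])
  have mono: "strict_mono_on {\<eta> j..\<eta> (j + 1)} ?e \<or> strict_antimono_on {\<eta> j..\<eta> (j + 1)} ?e"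
    if "j \<in> {1..2 * n + 1}" for j
    using strictly_monotonic_between[of j] that by simp
  show ?thesis
    by (intro conjI ballI at_eta ext extremal_points mono exI[of _ x])
      (use x g_node r_node in auto)
qed

end
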